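(* Let $\mathcal{H}\in\mathfrak{C}^1([-1,1])$ and $r_0>0$. If the $\mathcal{H}$-catenoid $\Sigma_{\mathcal{H}}(r_0)$ has unbounded (resp. bounded) upper height, then all the $\mathcal{H}$-catenoids $\Sigma_{\mathcal{H}}(r)$, $r>0$, have unbounded (resp. bounded) upper height. Likewise, if $\Sigma_{\mathcal{H}}(r_0)$ has unbounded (resp. bounded) lower height, then all the $\mathcal{H}$-catenoids $\Sigma_{\mathcal{H}}(r)$, $r>0$, have unbounded (resp. bounded) lower height.
   Context: $\mathfrak{C}^1([-1,1]):=\{\mathcal{H}\in C^1([-1,1]):\ \mathcal{H}(y)<0\ \text{for all } y\in(-1,1),\ \mathcal{H}(-1)=\mathcal{H}(1)=0\}$. For $\mathcal{H}\in\mathfrak{C}^1([-1,1])$, an $\mathcal{H}$-surface is an immersed oriented surface $\Sigma\subset\mathbb{R}^3$ with unit normal $\eta$ whose mean curvature (half the sum of principal curvatures) is $H_\Sigma=\mathcal{H}(\langle\eta,e_3\rangle)$, $e_3=(0,0,1)$. For every $r_0>0$ the $\mathcal{H}$-catenoid $\Sigma_{\mathcal{H}}(r_0)$ is the (known to exist and unique) properly embedded annular $\mathcal{H}$-surface, rotationally symmetric about the $z$-axis, which is a bi-graph over the exterior of the disk $D(0,r_0)$ in $\{z=0\}$, meeting $\{z=0\}$ orthogonally along its waist, the circle of radius $r_0$ (its necksize); its unit normal points inwards at the waist, upwards on the upper end $\Sigma_{\mathcal{H}}^+(r_0)=\Sigma_{\mathcal{H}}(r_0)\cap\{z\ge0\}$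 and downwards on the lower end $\Sigma_{\mathcal{H}}^-(r_0)=\Sigma_{\mathcal{H}}(r_0)\cap\{z\le0\}$. The upper and lower ends are obtained by rotating about the $z$-axis the graphs $z=f_+(x)$ and $z=f_-(x)$, $x>r_0$, where $f_+$ (upper height) and $f_-$ (lower height) satisfy $$2\mathcal{H}\Big(\tfrac{1}{\sqrt{1+f_+'^2}}\Big)=\frac{f_+''}{(1+f_+'^2)^{3/2}}+\frac{f_+'}{x\sqrt{1+f_+'^2}},\qquad -2\mathcal{H}\Big(\tfrac{-1}{\sqrt{1+f_-'^2}}\Big)=\frac{f_-''}{(1+f_-'^2)^{3/2}}+\frac{f_-'}{x\sqrt{1+f_-'^2}},$$ with $f_\pm(x)\to0$ and $f_\pm'(x)\to\pm\infty$ as $x\to r_0^+$. $\Sigma_{\mathcal{H}}(r_0)$ has unbounded (bounded) upper height if $f_+$ is unbounded (bounded) on $(r_0,\infty)$, and unbounded (bounded) lower height if $f_-$ is unbounded (bounded). *)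

theory Defs
  imports "HOL-Analysis.Analysis"
begin

definition frakC1 :: "(real \<Rightarrow> real) set" where
  "frakC1 = {H. (\<exists>H'. (\<forall>y\<in>{-1..1}. (H has_real_derivative H' y) (at y within {-1..1})) \<and>
                      continuous_on {-1..1} H') \<and>
               (\<forall>y\<in>{-1<..<1}. H y < 0) \<and> H (-1) = 0 \<and> H 1 = 0}"

definition e3 :: "real^3" where
  "e3 = vector [0, 0, 1]"

definition dird :: "('a::real_normed_vector \<Rightarrow> 'b::real_normed_vector) \<Rightarrow> 'a \<Rightarrow> 'a \<Rightarrow> 'b" where
  "dird X p v = frechet_derivative X (at p) v"

(* For U open: twice continuously differentiable. Continuity of X and of its first
   derivatives is implied by their differentiability. *)
definition C2_on :: "('a::real_normed_vector) set \<Rightarrow> ('a \<Rightarrow> 'b::real_normed_vector) \<Rightarrow> bool" where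
  "C2_on U X \<longleftrightarrow>
     (\<forall>p\<in>U. X differentiable (at p)) \<and>
     (\<forall>v. \<forall>p\<in>U. (\<lambda>q. dird X q v) differentiable (at p)) \<and>
     (\<forall>v w. continuous_on U (\<lambda>p. dird (\<lambda>q. dird X q v) p w))"

definition chart :: "(real^3) set \<Rightarrow> (real \<times> real) set \<Rightarrow> (real \<times> real \<Rightarrow> real^3) \<Rightarrow> bool" where
  "chart S U X \<longleftrightarrow>
     open U \<and> C2_on U X \<and> (\<forall>p\<in>U. inj (frechet_derivative X (at p))) \<and>
     openin (top_of_set S) (X ` U) \<and> (\<exists>Y. homeomorphism U (X ` U) X Y)"

definition embedded_surface :: "(real^3) set \<Rightarrow> bool" where
  "embedded_surface S \<longleftrightarrow> (\<forall>s\<in>S. \<exists>U X. chart S U X \<and> s \<in> X ` U)"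

definition unit_normal :: "(real^3) set \<Rightarrow> (real^3 \<Rightarrow> real^3) \<Rightarrow> bool" where
  "unit_normal S \<eta> \<longleftrightarrow>
     continuous_on S \<eta> \<and> (\<forall>s\<in>S. norm (\<eta> s) = 1) \<and>
     (\<forall>U X. chart S U X \<longrightarrow> (\<forall>p\<in>U. \<forall>v. \<eta> (X p) \<bullet> dird X p v = 0))"

definition first_form ::
    "(real \<times> real \<Rightarrow> real^3) \<Rightarrow> real \<times> real \<Rightarrow> real \<times> real \<Rightarrow> real \<times> real \<Rightarrow> real" where
  "first_form X p v w = dird X p v \<bullet> dird X p w"

(* Sign convention: a round sphere with its inner normal has positive curvatures. *)
definition second_form ::
    "(real \<times> real \<Rightarrow> real^3) \<Rightarrow> real^3 \<Rightarrow> real \<times> real \<Rightarrow> real \<times> real \<Rightarrow> real \<times> real \<Rightarrow> real" where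
  "second_form X n p v w = dird (\<lambda>q. dird X q v) p w \<bullet> n"

(* k1, k2 are the eigenvalues, with multiplicity, of the shape operator: the values of the
   second form on an orthonormal tangent basis that diagonalizes it. *)
definition principal_curvatures ::
    "(real \<times> real \<Rightarrow> real^3) \<Rightarrow> real^3 \<Rightarrow> real \<times> real \<Rightarrow> real \<Rightarrow> real \<Rightarrow> bool" where
  "principal_curvatures X n p k1 k2 \<longleftrightarrow>
     (\<exists>v w. first_form X p v v = 1 \<and> first_form X p w w = 1 \<and> first_form X p v w = 0 \<and>
            second_form X n p v w = 0 \<and>
            second_form X n p v v = k1 \<and> second_form X n p w w = k2)"

(* Embedded oriented H-surface. Principal curvatures exist at every point by the spectral
   theorem and do not depend on the chart, so the universal quantifiers below are harmless. *)
definition H_surface :: "(real \<Rightarrow> real) \<Rightarrow> (real^3) set \<Rightarrow> (real^3 \<Rightarrow> real^3) \<Rightarrow> bool" where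
  "H_surface H S \<eta> \<longleftrightarrow>
     embedded_surface S \<and> unit_normal S \<eta> \<and>
     (\<forall>U X. chart S U X \<longrightarrow>
        (\<forall>p\<in>U. \<forall>k1 k2. principal_curvatures X (\<eta> (X p)) p k1 k2 \<longrightarrow>
                 (k1 + k2) / 2 = H (\<eta> (X p) \<bullet> e3)))"

definition rotz :: "real \<Rightarrow> real^3 \<Rightarrow> real^3" where
  "rotz t p = vector [cos t * p$1 - sin t * p$2, sin t * p$1 + cos t * p$2, p$3]"

definition waist :: "real \<Rightarrow> (real^3) set" where
  "waist r = {p. (p$1)\<^sup>2 + (p$2)\<^sup>2 = r\<^sup>2 \<and> p$3 = 0}"

definition rotated_graph :: "real \<Rightarrow> (real \<Rightarrow> real) \<Rightarrow> (real^3) set" where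
  "rotated_graph r f = {rotz t (vector [x, 0, f x]) | t x. x > r}"

definition C2_profile :: "real \<Rightarrow> (real \<Rightarrow> real) \<Rightarrow> bool" where
  "C2_profile r f \<longleftrightarrow>
     (\<forall>x>r. f field_differentiable (at x)) \<and>
     (\<forall>x>r. deriv f field_differentiable (at x)) \<and>
     continuous_on {r<..} (deriv (deriv f))"

(* On {r<..} the height functions are determined by S. *)
definition upper_height :: "real \<Rightarrow> (real^3) set \<Rightarrow> (real \<Rightarrow> real) \<Rightarrow> bool" where
  "upper_height r S f \<longleftrightarrow>
     S \<inter> {p. p$3 \<ge> 0} = waist r \<union> rotated_graph r f \<and> C2_profile r f \<and>
     (f \<longlongrightarrow> 0) (at_right r) \<and> filterlim (deriv f) at_top (at_right r)"

definition lower_height :: "real \<Rightarrow> (real^3) set \<Rightarrow> (real \<Rightarrow> real) \<Rightarrow> bool" where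
  "lower_height r S f \<longleftrightarrow>
     S \<inter> {p. p$3 \<le> 0} = waist r \<union> rotated_graph r f \<and> C2_profile r f \<and>
     (f \<longlongrightarrow> 0) (at_right r) \<and> filterlim (deriv f) at_bot (at_right r)"

(* Closedness together with embeddedness is proper embeddedness. The condition on the
   normal along the waist says both that it points inwards and, being horizontal, that
   S meets the plane z = 0 orthogonally. *)
definition H_catenoid :: "(real \<Rightarrow> real) \<Rightarrow> real \<Rightarrow> (real^3) set \<Rightarrow> bool" where
  "H_catenoid H r S \<longleftrightarrow>
     closed S \<and>
     S homeomorphic (sphere (0::complex) 1 \<times> (UNIV :: real set)) \<and>
     (\<forall>t. rotz t ` S = S) \<and>
     S \<inter> {p. p$3 = 0} = waist r \<and>
     (\<exists>f. upper_height r S f) \<and> (\<exists>f. lower_height r S f) \<and>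
     (\<exists>\<eta>. H_surface H S \<eta> \<and>
          (\<forall>p\<in>waist r. \<eta> p = - (p /\<^sub>R r)) \<and>
          (\<forall>p\<in>S. p$3 > 0 \<longrightarrow> \<eta> p \<bullet> e3 > 0) \<and>
          (\<forall>p\<in>S. p$3 < 0 \<longrightarrow> \<eta> p \<bullet> e3 < 0))"

definition bounded_upper_height :: "real \<Rightarrow> (real^3) set \<Rightarrow> bool" where
  "bounded_upper_height r S \<longleftrightarrow> (\<exists>f. upper_height r S f \<and> bounded (f ` {r<..}))"

definition unbounded_upper_height :: "real \<Rightarrow> (real^3) set \<Rightarrow> bool" where
  "unbounded_upper_height r S \<longleftrightarrow> (\<exists>f. upper_height r S f \<and> \<not> bounded (f ` {r<..}))"

definition bounded_lower_height :: "real \<Rightarrow> (real^3) set \<Rightarrow> bool" where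
  "bounded_lower_height r S \<longleftrightarrow> (\<exists>f. lower_height r S f \<and> bounded (f ` {r<..}))"

definition unbounded_lower_height :: "real \<Rightarrow> (real^3) set \<Rightarrow> bool" where
  "unbounded_lower_height r S \<longleftrightarrow> (\<exists>f. lower_height r S f \<and> \<not> bounded (f ` {r<..}))"

end

theory Submission
  imports Defs
begin

text \<open>
  Boundedness of the height does not depend on the necksize because homotheties turn catenoids
  into barriers. Along an end with height \<open>f\<close> the prescribed mean curvature is a first-order
  equation for the slope \<open>f'\<close>, singular at the waist, where the slope is infinite. Given two
  catenoids with heights \<open>f\<close> and \<open>g\<close> and necksizes \<open>r\<close> and \<open>s\<close>, choose a dilation
  factor \<open>k > 1\<close> with \<open>k * r > s\<close>. The profile \<open>f\<close> dilated by \<open>k\<close> has its mean curvature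
  divided by \<open>k\<close>; since \<open>H < 0\<close>, this exceeds what the equation prescribes. Its slope
  \<open>f' (x / k)\<close> starts at infinity at the radius \<open>k * r\<close>, where \<open>g'\<close> is finite, and cannot be
  overtaken by \<open>g'\<close> afterwards (\<open>slope_below_rescaled_slope\<close>). Integration yields
  \<open>g x \<le> k * f (x / k) + const\<close>, so boundedness of \<open>f\<close> implies that of \<open>g\<close>
  (\<open>bounded_height_transfer\<close>). The two catenoids are arbitrary, so the contrapositive
  transfers unboundedness.

  At a contact the strict inequality needs \<open>H\<close> at a point of \<open>(-1, 1)\<close>, that is, a nonzero
  slope. If \<open>g'\<close> is nonpositive somewhere, it stays so (\<open>slope_nonpos_persists\<close>), and \<open>g\<close>
  is bounded for the simple reason that it is positive and eventually nonincreasing.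

  That the slope satisfies the equation is read off from a chart of the surface in polar
  coordinates (\<open>end_profile_equation\<close>). A sign \<open>\<sigma>\<close> handles both ends at once: the lower
  end for \<open>H\<close> is, after a reflection in the plane of the waist, an upper end for
  \<open>y \<mapsto> H (- y)\<close>.
\<close>

section \<open>Comparison of profiles with different necksizes\<close>

text \<open>At its first zero after \<open>a\<close> the function \<open>d\<close> would come down from positive values and so
  could not be strictly increasing. Both comparison arguments below are instances.\<close>

lemma positive_persists:
  fixes d d' :: "real \<Rightarrow> real"
  assumes "a \<le> b" and "0 < d a"
    and der: "\<And>x. a \<le> x \<Longrightarrow> x \<le> b \<Longrightarrow> (d has_real_derivative d' x) (at x)"
    and cross: "\<And>x. a \<le> x \<Longrightarrow> x \<le> b \<Longrightarrow> d x = 0 \<Longrightarrow> 0 < d' x"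
  shows "0 < d b"
proof (rule ccontr)
  assume neg: "\<not> 0 < d b"
  have cont: "continuous_on {a..b} d"
    using der by (meson DERIV_isCont atLeastAtMost_iff continuous_at_imp_continuous_on)
  define Z where "Z = {a..b} \<inter> d -` {..0}"
  have "closed Z" unfolding Z_def
    by (rule continuous_closed_preimage[OF cont]) auto
  then have "compact Z"
    using compact_Int_closed[OF compact_Icc] by (metis Z_def inf.absorb2 inf_le1)
  moreover have "Z \<noteq> {}" using neg \<open>a \<le> b\<close> by (auto simp: Z_def)
  ultimately obtain c where c: "c \<in> Z" and least: "\<And>z. z \<in> Z \<Longrightarrow> c \<le> z"
    using compact_attains_inf by metis
  have ac: "a < c" "c \<le> b" "d c \<le> 0" using c \<open>0 < d a\<close> unfolding Z_def
    by (auto simp: order_less_le)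
  have "\<exists>z\<ge>a. z \<le> c \<and> d z = 0"
    using IVT2'[of d c 0 a] ac \<open>0 < d a\<close> continuous_on_subset[OF cont] by auto
  then obtain z where "a \<le> z" "z \<le> c" "d z = 0" by blast
  with least[of z] ac have dc: "d c = 0" by (auto simp: Z_def)
  with cross ac have "0 < d' c" by auto
  with der[of c] ac obtain e where e: "e > 0" "\<And>h. 0 < h \<Longrightarrow> h < e \<Longrightarrow> d (c - h) < d c"
    using DERIV_pos_inc_left[of d "d' c" c] by auto
  define h where "h = min (e / 2) (c - a)"
  have "0 < h" "h < e" "h \<le> c - a" using e ac by (auto simp: h_def)
  with e dc ac have "c - h \<in> Z" by (force simp: Z_def)
  with least \<open>0 < h\<close> show False by fastforce
qed

text \<open>A height above the waist together with its slope \<open>f'\<close>. The equation is the prescribed mean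
  curvature equation \<open>2 h(1 / sqrt (1 + f'^2)) = f'' / (1 + f'^2)^(3/2) + f' / (x sqrt (1 + f'^2))\<close>
  solved for \<open>f''\<close>; as the height itself does not occur in it, it is a first-order equation
  for the slope.\<close>

definition height_profile ::
    "(real \<Rightarrow> real) \<Rightarrow> real \<Rightarrow> (real \<Rightarrow> real) \<Rightarrow> (real \<Rightarrow> real) \<Rightarrow> bool" where
  "height_profile h r f f' \<longleftrightarrow>
     (\<forall>x>r. 0 < f x) \<and> (f \<longlongrightarrow> 0) (at_right r) \<and> filterlim f' at_top (at_right r) \<and>
     (\<forall>x>r. (f has_real_derivative f' x) (at x)) \<and>
     (\<forall>x>r. (f' has_real_derivative
        (1 + (f' x)\<^sup>2) * (2 * sqrt (1 + (f' x)\<^sup>2) * h (1 / sqrt (1 + (f' x)\<^sup>2)) - f' x / x)) (at x))"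

lemma profile_rhs_neg:
  fixes q :: real
  assumes "\<And>y. 0 < y \<Longrightarrow> y < 1 \<Longrightarrow> h y < (0::real)" and "0 < q"
  shows "(1 + q\<^sup>2) * (2 * sqrt (1 + q\<^sup>2) * h (1 / sqrt (1 + q\<^sup>2))) < 0"
proof -
  define s where "s = sqrt (1 + q\<^sup>2)"
  have "1 < s" using \<open>0 < q\<close> by (simp add: s_def)
  then have "h (1 / s) < 0" by (intro assms) simp_all
  moreover have "0 < 2 * s" "0 < 1 + q\<^sup>2" using \<open>1 < s\<close> by (simp_all add: add_pos_nonneg)
  ultimately show ?thesis unfolding s_def[symmetric] by (simp add: mult_pos_neg)
qed

text \<open>While the slope is positive, both terms of the equation make it decrease, so it cannot climb
  to any level \<open>e > 0\<close> once it has been nonpositive.\<close>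

lemma slope_nonpos_persists:
  assumes f: "height_profile h r f f'" and h: "\<And>y. 0 < y \<Longrightarrow> y < 1 \<Longrightarrow> h y < 0"
    and "0 < r" "r < a" "f' a \<le> 0" "a \<le> x"
  shows "f' x \<le> 0"
proof (rule field_le_epsilon)
  fix e :: real assume "0 < e"
  have "0 < e - f' x"
  proof (rule positive_persists[where d = "\<lambda>x. e - f' x"])
    fix y assume y: "a \<le> y" "y \<le> x"
    show "((\<lambda>x. e - f' x) has_real_derivative - ((1 + (f' y)\<^sup>2) *
        (2 * sqrt (1 + (f' y)\<^sup>2) * h (1 / sqrt (1 + (f' y)\<^sup>2)) - f' y / y))) (at y)"
      using f y \<open>r < a\<close> unfolding height_profile_def
      by (auto intro!: derivative_eq_intros)
    assume "e - f' y = 0"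
    then have "f' y = e" by simp
    moreover have "0 < (1 + e\<^sup>2) * (e / y)"
      using \<open>0 < e\<close> y \<open>0 < r\<close> \<open>r < a\<close> by (intro mult_pos_pos) (auto simp: add_pos_nonneg)
    ultimately show "0 < - ((1 + (f' y)\<^sup>2) *
        (2 * sqrt (1 + (f' y)\<^sup>2) * h (1 / sqrt (1 + (f' y)\<^sup>2)) - f' y / y))"
      using profile_rhs_neg[of h e, OF h \<open>0 < e\<close>] by (simp add: right_diff_distrib)
  qed (use assms \<open>0 < e\<close> in auto)
  then show "f' x \<le> 0 + e" by simp
qed

text \<open>This is the heart of the proof. Dilating a profile by the factor \<open>k\<close> multiplies its waist
  radius by \<open>k\<close> and divides its curvature by \<open>k\<close>. As the prescribed curvature is negative,
  division by \<open>k > 1\<close> raises it, so that the slope \<open>f' (x / k)\<close> of the dilated profile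
  increases strictly faster than \<open>g'\<close> wherever the two agree. At the dilated waist \<open>k * r\<close>,
  which lies beyond the waist of \<open>g\<close>, the dilated slope is infinite and \<open>g'\<close> is finite.\<close>

lemma slope_below_rescaled_slope:
  assumes f: "height_profile h r f f'" and g: "height_profile h s g g'"
    and h: "\<And>y. 0 < y \<Longrightarrow> y < 1 \<Longrightarrow> h y < 0"
    and "1 < k" "s < k * r"
    and pos: "\<And>x. s < x \<Longrightarrow> 0 < g' x" and x: "k * r < x"
  shows "g' x < f' (x / k)"
proof -
  have "0 < k" using \<open>1 < k\<close> by simp
  have "isCont g' (k * r)"
    using g \<open>s < k * r\<close> unfolding height_profile_def by (blast intro: DERIV_isCont)
  then have "isCont (\<lambda>y. g' (k * y)) r"
    by (intro isCont_o2[where f = "\<lambda>y. k * y" and g = g']) simp_all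
  then have "((\<lambda>y. g' (k * y)) \<longlongrightarrow> g' (k * r)) (at_right r)"
    by (simp add: isCont_def filterlim_at_split)
  then have "eventually (\<lambda>y. g' (k * y) < g' (k * r) + 1) (at_right r)"
    by (rule order_tendstoD) simp
  moreover have "eventually (\<lambda>y. g' (k * r) + 1 < f' y) (at_right r)"
    using f unfolding height_profile_def filterlim_at_top_dense by blast
  moreover have "eventually (\<lambda>y. y \<in> {r<..<x / k}) (at_right r)"
    using x \<open>0 < k\<close> by (intro eventually_at_right_real) (simp add: field_simps)
  \<comment> \<open>A starting point of the comparison, between the dilated waist and \<open>x\<close>.\<close>
  ultimately have "eventually (\<lambda>y. g' (k * y) < f' y \<and> y \<in> {r<..<x / k}) (at_right r)"
    by eventually_elim auto
  then obtain y where y: "g' (k * y) < f' y" "r < y" "y < x / k"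
    using eventually_happens by fastforce
  have "0 < f' (x / k) - g' x"
  proof (rule positive_persists[where d = "\<lambda>x. f' (x / k) - g' x"])
    show "k * y \<le> x" "0 < f' (k * y / k) - g' (k * y)"
      using y \<open>0 < k\<close> by (auto simp: field_simps)
    fix z assume z: "k * y \<le> z" "z \<le> x"
    let ?F = "\<lambda>q z. (1 + q\<^sup>2) * (2 * sqrt (1 + q\<^sup>2) * h (1 / sqrt (1 + q\<^sup>2)) - q / z)"
    have "k * r < k * y" using y \<open>0 < k\<close> by simp
    also note z(1)
    finally have "k * r < z" .
    then have zr: "r < z / k" "s < z"
      using \<open>0 < k\<close> \<open>s < k * r\<close> by (auto simp: field_simps)
    have "(f' has_real_derivative ?F (f' (z / k)) (z / k)) (at (z / k))"
      using f zr unfolding height_profile_def by blast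
    then have "((\<lambda>x. f' (x / k)) has_real_derivative ?F (f' (z / k)) (z / k) * (1 / k)) (at z)"
      by (rule DERIV_chain2) (use \<open>0 < k\<close> in \<open>auto intro!: derivative_eq_intros\<close>)
    moreover have "(g' has_real_derivative ?F (g' z) z) (at z)"
      using g zr unfolding height_profile_def by blast
    ultimately show "((\<lambda>x. f' (x / k) - g' x) has_real_derivative
        ?F (f' (z / k)) (z / k) * (1 / k) - ?F (g' z) z) (at z)"
      by (rule DERIV_diff)
    assume "f' (z / k) - g' z = 0"
    then have eq: "f' (z / k) = g' z" by simp
    let ?q = "g' z"
    let ?P = "(1 + ?q\<^sup>2) * (2 * sqrt (1 + ?q\<^sup>2) * h (1 / sqrt (1 + ?q\<^sup>2)))"
    have "?P < 0" by (rule profile_rhs_neg[of h, OF h pos]) (use zr in auto)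
    moreover have "1 / k - 1 < 0" using \<open>1 < k\<close> by simp
    ultimately have "0 < (1 / k - 1) * ?P" by (rule mult_neg_neg[rotated])
    \<comment> \<open>The terms with the slope over the radius are invariant under dilation and cancel.\<close>
    also have "\<dots> = ?F (f' (z / k)) (z / k) * (1 / k) - ?F (g' z) z"
      unfolding eq using \<open>0 < k\<close> by (simp add: algebra_simps)
    finally show "0 < ?F (f' (z / k)) (z / k) * (1 / k) - ?F (g' z) z" .
  qed
  then show ?thesis by simp
qed

lemma height_bounded_near_waist:
  assumes f: "height_profile h r f f'"
  shows "\<exists>B. \<forall>x. r < x \<and> x \<le> a \<longrightarrow> f x \<le> B"
proof -
  have "eventually (\<lambda>x. f x < 1) (at_right r)"
    using f unfolding height_profile_def by (auto intro: order_tendstoD)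
  then obtain b where b: "r < b" "\<And>x. r < x \<Longrightarrow> x < b \<Longrightarrow> f x < 1"
    by (auto simp: eventually_at_right_field)
  have "isCont f x" if "r < x" for x
    using f that unfolding height_profile_def by (blast intro: DERIV_isCont)
  then have "continuous_on {b..a} f"
    using \<open>r < b\<close> by (intro continuous_at_imp_continuous_on) auto
  then have "bounded (f ` {b..a})"
    by (intro compact_imp_bounded compact_continuous_image) auto
  then obtain B where B: "\<And>x. b \<le> x \<Longrightarrow> x \<le> a \<Longrightarrow> norm (f x) \<le> B"
    unfolding bounded_iff by (metis atLeastAtMost_iff imageI)
  have "f x \<le> max 1 B" if "r < x" "x \<le> a" for x
    using b(2)[of x] B[of x] that by (cases "x < b") auto
  then show ?thesis by blast
qed

text \<open>If \<open>g\<close> stops increasing it is trivially bounded above. Otherwise integrating the comparison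
  of slopes bounds \<open>g x\<close> by \<open>k * f (x / k)\<close> up to a constant. The waists may come in either
  order, because the dilation factor may be as large as one likes.\<close>

lemma bounded_height_transfer:
  assumes f: "height_profile h r f f'" and g: "height_profile h s g g'"
    and h: "\<And>y. 0 < y \<Longrightarrow> y < 1 \<Longrightarrow> h y < 0"
    and "0 < r" "0 < s" and bdd: "bounded (f ` {r<..})"
  shows "bounded (g ` {s<..})"
proof -
  have dg: "(g has_real_derivative g' x) (at x)" if "s < x" for x
    using g that unfolding height_profile_def by blast
  have df: "(f has_real_derivative f' x) (at x)" if "r < x" for x
    using f that unfolding height_profile_def by blast
  have "\<exists>a>s. \<exists>B. \<forall>x\<ge>a. g x \<le> B"
  proof (cases "\<forall>x>s. 0 < g' x")
    case False
    then obtain a where a: "s < a" "g' a \<le> 0" by force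
    have "g x \<le> g a" if "a \<le> x" for x
    proof (rule DERIV_nonpos_imp_nonincreasing[OF that])
      fix y assume y: "a \<le> y" "y \<le> x"
      then show "\<exists>z. (g has_real_derivative z) (at y) \<and> z \<le> 0"
        using dg[of y] slope_nonpos_persists[OF g h \<open>0 < s\<close> a y(1)] a by auto
    qed
    with a show ?thesis by blast
  next
    case True
    \<comment> \<open>Any factor \<open>k > 1\<close> that carries the waist of \<open>f\<close> beyond that of \<open>g\<close> serves.\<close>
    define k where "k = 1 + s / r"
    have k: "1 < k" "s < k * r" "0 < k"
      using \<open>0 < r\<close> \<open>0 < s\<close> by (auto simp: k_def field_simps add_pos_pos)
    obtain B where B: "\<And>x. r < x \<Longrightarrow> \<bar>f x\<bar> \<le> B"
      using bdd unfolding bounded_iff by (metis greaterThan_iff imageI real_norm_def)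
    define a where "a = k * r + 1"
    have "g x \<le> k * B - (k * f (a / k) - g a)" if "a \<le> x" for x
    proof -
      have "k * f (a / k) - g a \<le> k * f (x / k) - g x"
      proof (rule DERIV_nonneg_imp_nondecreasing[OF that])
        fix y assume y: "a \<le> y" "y \<le> x"
        then have y': "k * r < y" by (simp add: a_def)
        then have "r < y / k" using k by (simp add: field_simps)
        then have "((\<lambda>x. f (x / k)) has_real_derivative f' (y / k) * (1 / k)) (at y)"
          by (intro DERIV_chain2[OF df]) (use k in \<open>auto intro!: derivative_eq_intros\<close>)
        from DERIV_diff[OF DERIV_cmult[OF this, of k] dg[of y]]
        have "((\<lambda>x. k * f (x / k) - g x) has_real_derivative f' (y / k) - g' y) (at y)"
          using k y' by simp
        moreover have "g' y < f' (y / k)"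
          using slope_below_rescaled_slope[OF f g h] k True y' by blast
        ultimately show "\<exists>z. ((\<lambda>x. k * f (x / k) - g x) has_real_derivative z) (at y) \<and> 0 \<le> z"
          by force
      qed
      moreover have "r < x / k" using that k by (simp add: a_def field_simps)
      then have "f (x / k) \<le> B" using B by fastforce
      then have "k * f (x / k) \<le> k * B" using k by simp
      ultimately show ?thesis by simp
    qed
    moreover have "s < a" using k by (simp add: a_def)
    ultimately show ?thesis by blast
  qed
  then obtain a B where B: "\<And>x. a \<le> x \<Longrightarrow> g x \<le> B" by blast
  obtain C where C: "\<And>x. s < x \<Longrightarrow> x \<le> a \<Longrightarrow> g x \<le> C"
    using height_bounded_near_waist[OF g] by blast
  have "norm (g x) \<le> max B C" if "s < x" for x
    using B[of x] C[of x] g that unfolding height_profile_def by (cases "x \<le> a") fastforce+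
  then show ?thesis by (auto simp: bounded_iff)
qed

section \<open>The profile equation of a rotational end\<close>

lemma vector_3_axis:
  "(vector [a, b, c] :: real^3) = a *\<^sub>R axis 1 1 + b *\<^sub>R axis 2 1 + c *\<^sub>R axis 3 1"
  by (simp add: vec_eq_iff forall_3 axis_def)

lemma inner_vector_3:
  "(vector [a, b, c] :: real^3) \<bullet> vector [a', b', c'] = a * a' + b * b' + c * c'"
  by (simp add: inner_vec_def sum_3)

text \<open>The surface of revolution with profile \<open>f\<close> is parametrized by radius and angle rather than
  as a graph over the plane: the derivatives of the profile then enter the first and second
  derivatives linearly, and the coordinate directions turn out to be the principal ones.\<close>

definition polar_patch :: "(real \<Rightarrow> real) \<Rightarrow> real \<times> real \<Rightarrow> real^3" where
  "polar_patch f p = vector [fst p * cos (snd p), fst p * sin (snd p), f (fst p)]"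

definition polar_patch_d :: "(real \<Rightarrow> real) \<Rightarrow> real \<times> real \<Rightarrow> real \<times> real \<Rightarrow> real^3" where
  "polar_patch_d f' p v = vector
     [fst v * cos (snd p) - fst p * sin (snd p) * snd v,
      fst v * sin (snd p) + fst p * cos (snd p) * snd v,
      f' (fst p) * fst v]"

definition polar_patch_dd ::
    "(real \<Rightarrow> real) \<Rightarrow> real \<times> real \<Rightarrow> real \<times> real \<Rightarrow> real \<times> real \<Rightarrow> real^3" where
  "polar_patch_dd f'' p v w = vector
     [- sin (snd p) * (fst v * snd w + snd v * fst w) - fst p * cos (snd p) * snd v * snd w,
      cos (snd p) * (fst v * snd w + snd v * fst w) - fst p * sin (snd p) * snd v * snd w,
      f'' (fst p) * fst v * fst w]"

lemma has_derivative_fun_fst: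
  assumes "(f has_real_derivative D) (at (fst p))"
  shows "((\<lambda>q. f (fst q)) has_derivative (\<lambda>v. D * fst v)) (at (p :: real \<times> real))"
  by (rule has_derivative_compose[where f = fst and g = f])
     (use assms in \<open>auto simp: has_field_derivative_def intro!: derivative_eq_intros\<close>)

lemma has_derivative_polar_patch:
  assumes "(f has_real_derivative f' (fst p)) (at (fst p))"
  shows "(polar_patch f has_derivative polar_patch_d f' p) (at p)"
  unfolding polar_patch_def[abs_def] polar_patch_d_def[abs_def] vector_3_axis
  by (rule derivative_eq_intros refl has_derivative_fun_fst[OF assms])+
     (simp add: algebra_simps)

lemma has_derivative_polar_patch_d:
  assumes "(f' has_real_derivative f'' (fst p)) (at (fst p))"
  shows "((\<lambda>q. polar_patch_d f' q v) has_derivative polar_patch_dd f'' p v) (at p)"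
  unfolding polar_patch_d_def polar_patch_dd_def[abs_def] vector_3_axis
  by (rule derivative_eq_intros refl has_derivative_fun_fst[OF assms])+
     (simp add: algebra_simps)

lemma dird_eq: "(X has_derivative D) (at p) \<Longrightarrow> dird X p v = D v"
  unfolding dird_def using frechet_derivative_at by metis

lemma dird_polar_patch:
  assumes "\<And>x. r < x \<Longrightarrow> (f has_real_derivative f' x) (at x)" "r < fst p"
  shows "dird (polar_patch f) p v = polar_patch_d f' p v"
  using assms by (intro dird_eq has_derivative_polar_patch) auto

lemma has_derivative_dird_polar_patch:
  assumes f: "\<And>x. r < x \<Longrightarrow> (f has_real_derivative f' x) (at x)"
    and f': "\<And>x. r < x \<Longrightarrow> (f' has_real_derivative f'' x) (at x)" and p: "r < fst p"
  shows "((\<lambda>q. dird (polar_patch f) q v) has_derivative polar_patch_dd f'' p v) (at p)"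
proof (rule has_derivative_transform_within_open)
  show "((\<lambda>q. polar_patch_d f' q v) has_derivative polar_patch_dd f'' p v) (at p)"
    using f' p by (intro has_derivative_polar_patch_d) auto
  show "open {q :: real \<times> real. r < fst q}" by (intro open_Collect_less continuous_intros)
qed (use p dird_polar_patch[OF f] in auto)

lemma dird2_polar_patch:
  assumes f: "\<And>x. r < x \<Longrightarrow> (f has_real_derivative f' x) (at x)"
    and f': "\<And>x. r < x \<Longrightarrow> (f' has_real_derivative f'' x) (at x)" and p: "r < fst p"
  shows "dird (\<lambda>q. dird (polar_patch f) q v) p w = polar_patch_dd f'' p v w"
  by (rule dird_eq, rule has_derivative_dird_polar_patch[OF assms])

text \<open>Half a turn of angles keeps the patch injective and lets \<open>arctan\<close> invert it.\<close>

definition polar_domain :: "real \<Rightarrow> (real \<times> real) set" where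
  "polar_domain r = {r<..} \<times> {- (pi / 2)<..<pi / 2}"

lemma C2_on_polar_patch:
  assumes f: "\<And>x. r < x \<Longrightarrow> (f has_real_derivative f' x) (at x)"
    and f': "\<And>x. r < x \<Longrightarrow> (f' has_real_derivative f'' x) (at x)"
    and f'': "continuous_on {r<..} f''"
  shows "C2_on (polar_domain r) (polar_patch f)"
  unfolding C2_on_def
proof (intro conjI allI ballI)
  fix p v assume "p \<in> polar_domain r"
  then have p: "r < fst p" by (auto simp: polar_domain_def)
  show "polar_patch f differentiable at p"
    using has_derivative_polar_patch[of f f' p] f p by (auto simp: differentiable_def)
  show "(\<lambda>q. dird (polar_patch f) q v) differentiable at p"
    using has_derivative_dird_polar_patch[OF f f' p] unfolding differentiable_def by blast
next
  fix v w
  have "continuous_on (polar_domain r) (\<lambda>p. polar_patch_dd f'' p v w)"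
    unfolding polar_patch_dd_def vector_3_axis
    by (intro continuous_intros continuous_on_compose2[OF f''])
       (auto simp: polar_domain_def)
  then show "continuous_on (polar_domain r)
      (\<lambda>p. dird (\<lambda>q. dird (polar_patch f) q v) p w)"
    by (rule continuous_on_eq) (auto simp: polar_domain_def dird2_polar_patch[OF f f'])
qed

text \<open>The horizontal part is a rotation after scaling the angular direction by the radius.\<close>

lemma inj_polar_patch_d:
  assumes "fst p \<noteq> 0"
  shows "inj (polar_patch_d f' p)"
proof (rule injI)
  fix v w assume eq: "polar_patch_d f' p v = polar_patch_d f' p w"
  define a b where "a = fst v - fst w" and "b = fst p * (snd v - snd w)"
  let ?c = "cos (snd p)" and ?s = "sin (snd p)"
  have "a * ?c - b * ?s = 0" "a * ?s + b * ?c = 0"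
    using arg_cong[OF eq, of "\<lambda>u. u $ 1"] arg_cong[OF eq, of "\<lambda>u. u $ 2"]
    unfolding polar_patch_d_def a_def b_def by (simp_all add: algebra_simps)
  moreover have "(a * ?c - b * ?s)\<^sup>2 + (a * ?s + b * ?c)\<^sup>2 = (a\<^sup>2 + b\<^sup>2) * (?s\<^sup>2 + ?c\<^sup>2)"
    by algebra
  ultimately have "a\<^sup>2 + b\<^sup>2 = 0" by simp
  then have "a = 0" "b = 0" by (auto simp: sum_power2_eq_zero_iff)
  then show "v = w" using assms by (auto simp: a_def b_def prod_eq_iff)
qed

lemma homeomorphism_polar_patch:
  assumes "0 \<le> r" and f: "continuous_on {r<..} f"
  shows "homeomorphism (polar_domain r) (polar_patch f ` polar_domain r) (polar_patch f)
           (\<lambda>p. (sqrt ((p$1)\<^sup>2 + (p$2)\<^sup>2), arctan (p$2 / p$1)))"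
proof (rule homeomorphismI)
  show "continuous_on (polar_domain r) (polar_patch f)"
    unfolding polar_patch_def[abs_def] vector_3_axis
    by (intro continuous_intros continuous_on_compose2[OF f]) (auto simp: polar_domain_def)
  have "p $ 1 \<noteq> 0" if "p \<in> polar_patch f ` polar_domain r" for p
    using that \<open>0 \<le> r\<close> cos_gt_zero_pi by (fastforce simp: polar_domain_def polar_patch_def)
  then show "continuous_on (polar_patch f ` polar_domain r)
      (\<lambda>p. (sqrt ((p$1)\<^sup>2 + (p$2)\<^sup>2), arctan (p$2 / p$1)))"
    by (auto intro!: continuous_intros)
  have left_inverse: "(sqrt ((polar_patch f q $ 1)\<^sup>2 + (polar_patch f q $ 2)\<^sup>2),
      arctan (polar_patch f q $ 2 / polar_patch f q $ 1)) = q" if q: "q \<in> polar_domain r" for q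
  proof -
    obtain x t where xt: "q = (x, t)" "r < x" "- (pi / 2) < t" "t < pi / 2"
      using q by (auto simp: polar_domain_def)
    have "x * sin t / (x * cos t) = tan t" using xt \<open>0 \<le> r\<close> by (simp add: tan_def)
    moreover have "(x * cos t)\<^sup>2 + (x * sin t)\<^sup>2 = x\<^sup>2"
      using sin_cos_squared_add[of t] by algebra
    ultimately show ?thesis
      using xt \<open>0 \<le> r\<close> by (simp add: polar_patch_def arctan_tan)
  qed
  then show "(sqrt ((polar_patch f q $ 1)\<^sup>2 + (polar_patch f q $ 2)\<^sup>2),
      arctan (polar_patch f q $ 2 / polar_patch f q $ 1)) = q" if "q \<in> polar_domain r" for q
    using that by blast
  show "(\<lambda>p. (sqrt ((p$1)\<^sup>2 + (p$2)\<^sup>2), arctan (p$2 / p$1))) ` polar_patch f ` polar_domain r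
      \<subseteq> polar_domain r"
    using left_inverse by auto
  show "polar_patch f (sqrt ((p$1)\<^sup>2 + (p$2)\<^sup>2), arctan (p$2 / p$1)) = p"
    if "p \<in> polar_patch f ` polar_domain r" for p
    using that left_inverse by auto
qed auto

lemma rotz_profile_point: "rotz t (vector [x, 0, z]) = vector [x * cos t, x * sin t, z]"
  by (simp add: rotz_def mult.commute)

text \<open>Here and below \<open>\<sigma> = 1\<close> selects the upper end of a catenoid and \<open>\<sigma> = -1\<close> the lower one.
  A point of the end at height zero would lie on the waist, but its distance to the axis exceeds
  \<open>r\<close>.\<close>

lemma end_off_plane:
  assumes "0 < r" and plane: "S \<inter> {p. p$3 = 0} = waist r"
    and half: "S \<inter> {p. 0 \<le> \<sigma> * p$3} = waist r \<union> rotated_graph r f"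
    and "\<sigma> \<noteq> 0" and x: "r < x"
  shows "0 < \<sigma> * f x"
proof -
  let ?p = "vector [x, 0, f x] :: real^3"
  have "?p = rotz 0 ?p" by (simp add: rotz_profile_point)
  then have "?p \<in> rotated_graph r f" using x unfolding rotated_graph_def by blast
  then have "?p \<in> S \<inter> {p. 0 \<le> \<sigma> * p$3}" using half by blast
  then have p: "?p \<in> S" "0 \<le> \<sigma> * f x" by auto
  have "?p \<notin> waist r"
    using x \<open>0 < r\<close> by (simp add: waist_def)
  moreover have "?p \<in> waist r" if "f x = 0"
    unfolding plane[symmetric] using p(1) that by simp
  ultimately have "f x \<noteq> 0" by blast
  with p(2) \<open>\<sigma> \<noteq> 0\<close> show ?thesis by (simp add: order_less_le)
qed

text \<open>The description of the image as a part of \<open>S\<close> cut out by strict inequalities makes it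
  relatively open in \<open>S\<close>, as a chart requires.\<close>

lemma polar_patch_image:
  assumes "0 < r" and plane: "S \<inter> {p. p$3 = 0} = waist r"
    and half: "S \<inter> {p. 0 \<le> \<sigma> * p$3} = waist r \<union> rotated_graph r f" and "\<sigma> \<noteq> 0"
  shows "polar_patch f ` polar_domain r = S \<inter> {p. 0 < p$1 \<and> 0 < \<sigma> * p$3}"
proof (intro equalityI subsetI)
  fix p assume "p \<in> polar_patch f ` polar_domain r"
  then obtain x t where xt: "r < x" "- (pi / 2) < t" "t < pi / 2"
    and p: "p = vector [x * cos t, x * sin t, f x]"
    by (auto simp: polar_domain_def polar_patch_def)
  have "p \<in> rotated_graph r f"
    unfolding rotated_graph_def p using xt rotz_profile_point by (metis (mono_tags, lifting) mem_Collect_eq)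
  with half have "p \<in> S" by blast
  moreover have "0 < \<sigma> * f x" using end_off_plane[OF assms(1-4)] xt by blast
  moreover have "0 < x * cos t" using xt \<open>0 < r\<close> cos_gt_zero_pi by simp
  ultimately show "p \<in> S \<inter> {p. 0 < p$1 \<and> 0 < \<sigma> * p$3}" by (simp add: p)
next
  fix p assume p: "p \<in> S \<inter> {p. 0 < p$1 \<and> 0 < \<sigma> * p$3}"
  then have "p \<in> waist r \<union> rotated_graph r f" using half by force
  moreover have "p \<notin> waist r" using p by (auto simp: waist_def)
  ultimately obtain x t where xt: "r < x" "p = vector [x * cos t, x * sin t, f x]"
    by (auto simp: rotated_graph_def rotz_profile_point)
  \<comment> \<open>The angle of \<open>p\<close> is known only up to full turns; this representative lies in the domain.\<close>
  define t' where "t' = arcsin (sin t)"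
  have "0 < cos t" using p xt \<open>0 < r\<close> by (simp add: zero_less_mult_iff)
  then have "cos t' = cos t"
    by (simp add: t'_def cos_arcsin flip: cos_squared_eq)
  moreover have "sin t' = sin t" by (simp add: t'_def)
  moreover have "(sin t)\<^sup>2 < 1"
    using zero_less_power[OF \<open>0 < cos t\<close>, of 2] sin_cos_squared_add[of t] by linarith
  then have "\<bar>sin t\<bar> < 1" by (simp add: abs_square_less_1)
  then have "- (pi / 2) < t'" "t' < pi / 2"
    unfolding t'_def using arcsin_lt_bounded[of "sin t"] by auto
  ultimately show "p \<in> polar_patch f ` polar_domain r"
    using xt by (intro image_eqI[of _ _ "(x, t')"]) (auto simp: polar_patch_def polar_domain_def)
qed

lemma chart_polar_patch:
  assumes "0 < r" and plane: "S \<inter> {p. p$3 = 0} = waist r"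
    and half: "S \<inter> {p. 0 \<le> \<sigma> * p$3} = waist r \<union> rotated_graph r f" and "\<sigma> \<noteq> 0"
    and f: "\<And>x. r < x \<Longrightarrow> (f has_real_derivative f' x) (at x)"
    and f': "\<And>x. r < x \<Longrightarrow> (f' has_real_derivative f'' x) (at x)"
    and f'': "continuous_on {r<..} f''"
  shows "chart S (polar_domain r) (polar_patch f)"
  unfolding chart_def
proof (intro conjI ballI)
  show "open (polar_domain r)" by (auto simp: polar_domain_def intro!: open_Times)
  show "C2_on (polar_domain r) (polar_patch f)" by (rule C2_on_polar_patch[OF f f' f''])
  fix p assume "p \<in> polar_domain r"
  then have p: "r < fst p" by (auto simp: polar_domain_def)
  have "frechet_derivative (polar_patch f) (at p) = polar_patch_d f' p"
    using frechet_derivative_at[OF has_derivative_polar_patch] f p by metis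
  then show "inj (frechet_derivative (polar_patch f) (at p))"
    using p \<open>0 < r\<close> by (simp add: inj_polar_patch_d)
next
  have "open {p :: real^3. 0 < p$1 \<and> 0 < \<sigma> * p$3}"
    by (intro open_Collect_conj open_Collect_less continuous_intros)
  then show "openin (top_of_set S) (polar_patch f ` polar_domain r)"
    unfolding polar_patch_image[OF assms(1-4)] by (rule openin_open_Int)
  have "continuous_on {r<..} f"
    using f by (intro continuous_at_imp_continuous_on ballI DERIV_isCont) auto
  then show "\<exists>Y. homeomorphism (polar_domain r) (polar_patch f ` polar_domain r) (polar_patch f) Y"
    using homeomorphism_polar_patch \<open>0 < r\<close> less_imp_le by blast
qed

text \<open>The chart exhibits both principal curvatures at the points of the profile curve itself, where
  the angle is zero: there the meridian and the parallel are orthogonal, the mixed second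
  derivative is tangential, and orthogonality to them determines the normal up to its sign, which
  is that of \<open>\<sigma>\<close>. Half the sum of the two curvatures is \<open>H\<close> of the vertical component
  \<open>\<sigma> / sqrt (1 + f'^2)\<close> of the normal, which is the equation after clearing denominators.\<close>

lemma end_profile_equation:
  assumes "0 < r" and plane: "S \<inter> {p. p$3 = 0} = waist r"
    and half: "S \<inter> {p. 0 \<le> \<sigma> * p$3} = waist r \<union> rotated_graph r f"
    and \<sigma>: "\<sigma> = 1 \<or> \<sigma> = -1"
    and f: "\<And>x. r < x \<Longrightarrow> (f has_real_derivative f' x) (at x)"
    and f': "\<And>x. r < x \<Longrightarrow> (f' has_real_derivative f'' x) (at x)"
    and f'': "continuous_on {r<..} f''"
    and surf: "H_surface H S \<eta>"
    and normal: "\<And>p. p \<in> S \<Longrightarrow> 0 < \<sigma> * p$3 \<Longrightarrow> 0 < \<sigma> * (\<eta> p \<bullet> e3)"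
    and x: "r < x"
  shows "\<sigma> * f'' x = (1 + (f' x)\<^sup>2) *
    (2 * sqrt (1 + (f' x)\<^sup>2) * H (\<sigma> / sqrt (1 + (f' x)\<^sup>2)) - \<sigma> * f' x / x)"
proof -
  have "\<sigma> \<noteq> 0" using \<sigma> by auto
  note chart = chart_polar_patch[OF assms(1-3) this f f' f'']
  define p where "p = (x, 0 :: real)"
  have pU: "p \<in> polar_domain r" using x by (simp add: p_def polar_domain_def)
  let ?P = "polar_patch f p"
  have "?P \<in> S \<inter> {p. 0 < p$1 \<and> 0 < \<sigma> * p$3}"
    using polar_patch_image[OF assms(1-3) \<open>\<sigma> \<noteq> 0\<close>] pU by blast
  then have P: "?P \<in> S" "0 < \<sigma> * (\<eta> ?P \<bullet> e3)" using normal by auto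
  define a b c where "a = \<eta> ?P $ 1" and "b = \<eta> ?P $ 2" and "c = \<eta> ?P $ 3"
  have \<eta>: "\<eta> ?P = vector [a, b, c]" by (simp add: vec_eq_iff forall_3 a_def b_def c_def)
  have \<eta>3: "\<eta> ?P \<bullet> e3 = c" by (simp add: \<eta> e3_def inner_vector_3)
  define q s where "q = f' x" and "s = sqrt (1 + q\<^sup>2)"
  have s: "0 < s" "s\<^sup>2 = 1 + q\<^sup>2" by (auto simp: s_def add_pos_nonneg)
  have d1: "dird (polar_patch f) p v = vector [fst v, x * snd v, q * fst v]" for v
    using dird_polar_patch[OF f, where p = p and v = v] x
    by (simp add: p_def polar_patch_d_def q_def)
  have d2: "dird (\<lambda>q. dird (polar_patch f) q v) p w =
      vector [- x * snd v * snd w, fst v * snd w + snd v * fst w, f'' x * fst v * fst w]" for v w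
    using dird2_polar_patch[OF f f', where p = p and v = v and w = w] x
    by (simp add: p_def polar_patch_dd_def)
  have "\<eta> ?P \<bullet> dird (polar_patch f) p v = 0" for v
    using surf chart pU unfolding H_surface_def unit_normal_def by blast
  from this[of "(1, 0)"] this[of "(0, 1)"] have a: "a = - (q * c)" and b: "b = 0"
    using x \<open>0 < r\<close> by (auto simp: d1 \<eta> inner_vector_3 mult.commute eq_neg_iff_add_eq_0)
  have "norm (\<eta> ?P) = 1"
    using surf P unfolding H_surface_def unit_normal_def by blast
  then have "a * a + b * b + c * c = 1" by (simp add: \<eta> norm_eq_1 inner_vector_3)
  then have "(c * s)\<^sup>2 = 1" using a b s(2) by (simp add: algebra_simps power2_eq_square)
  moreover have "0 < \<sigma> * (c * s)" using P \<eta>3 s by (simp add: mult.assoc[symmetric])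
  ultimately have "c * s = \<sigma>" using \<sigma> by (auto simp: power2_eq_1_iff)
  then have c: "c = \<sigma> / s" using s by (simp add: field_simps)
  \<comment> \<open>The curvatures of the meridian and of the parallel.\<close>
  let ?k1 = "f'' x * c / s\<^sup>2" and ?k2 = "q * c / x"
  have "principal_curvatures (polar_patch f) (\<eta> ?P) p ?k1 ?k2"
    unfolding principal_curvatures_def
  proof (intro exI conjI)
    let ?v = "(1 / s, 0 :: real)" and ?w = "(0 :: real, 1 / x)"
    show "first_form (polar_patch f) p ?v ?v = 1"
    proof -
      have "first_form (polar_patch f) p ?v ?v = (1 + q\<^sup>2) / s\<^sup>2"
        by (simp add: first_form_def d1 inner_vector_3 power2_eq_square add_divide_distrib)
      also have "\<dots> = 1" using s(1) by (simp flip: s(2))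
      finally show ?thesis .
    qed
    show "first_form (polar_patch f) p ?w ?w = 1" "first_form (polar_patch f) p ?v ?w = 0"
      using x \<open>0 < r\<close> by (simp_all add: first_form_def d1 inner_vector_3)
    show "second_form (polar_patch f) (\<eta> ?P) p ?v ?w = 0"
      using b by (simp add: second_form_def d2 \<eta> inner_vector_3)
    show "second_form (polar_patch f) (\<eta> ?P) p ?v ?v = ?k1"
      by (simp add: second_form_def d2 \<eta> inner_vector_3 power2_eq_square)
    show "second_form (polar_patch f) (\<eta> ?P) p ?w ?w = ?k2"
      using x \<open>0 < r\<close> a by (simp add: second_form_def d2 \<eta> inner_vector_3)
  qed
  then have "(?k1 + ?k2) / 2 = H (\<eta> ?P \<bullet> e3)"
    using surf chart pU unfolding H_surface_def by blast
  then have "f'' x * \<sigma> / (s * s\<^sup>2) + q * \<sigma> / (s * x) = 2 * H (\<sigma> / s)"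
    unfolding \<eta>3 c by (simp add: mult.commute)
  then have "f'' x * \<sigma> / (s * s\<^sup>2) = 2 * H (\<sigma> / s) - q * \<sigma> / (s * x)" by simp
  then have "f'' x * \<sigma> = (2 * H (\<sigma> / s) - q * \<sigma> / (s * x)) * (s * s\<^sup>2)"
    using s(1) by (simp add: divide_eq_eq)
  also have "\<dots> = s\<^sup>2 * (2 * s * H (\<sigma> / s) - \<sigma> * q / x)"
    using s(1) by (simp add: algebra_simps)
  finally show ?thesis unfolding s(2) unfolding s_def q_def by (simp add: mult.commute)
qed

section \<open>Independence of the necksize\<close>

definition end_height :: "real \<Rightarrow> real \<Rightarrow> (real^3) set \<Rightarrow> (real \<Rightarrow> real) \<Rightarrow> bool" where
  "end_height \<sigma> r S f \<longleftrightarrow>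
     S \<inter> {p. 0 \<le> \<sigma> * p$3} = waist r \<union> rotated_graph r f \<and> C2_profile r f \<and>
     (f \<longlongrightarrow> 0) (at_right r) \<and> filterlim (\<lambda>x. \<sigma> * deriv f x) at_top (at_right r)"

lemma upper_height_eq_end_height: "upper_height r S f \<longleftrightarrow> end_height 1 r S f"
  by (simp add: upper_height_def end_height_def)

lemma lower_height_eq_end_height: "lower_height r S f \<longleftrightarrow> end_height (- 1) r S f"
  by (simp add: lower_height_def end_height_def filterlim_uminus_at_top)

lemma end_height_imp_height_profile:
  assumes cat: "H_catenoid H r S" and "0 < r" and \<sigma>: "\<sigma> = 1 \<or> \<sigma> = -1"
    and hgt: "end_height \<sigma> r S f"
  shows "height_profile (\<lambda>y. H (\<sigma> * y)) r (\<lambda>x. \<sigma> * f x) (\<lambda>x. \<sigma> * deriv f x)"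
proof -
  have plane: "S \<inter> {p. p$3 = 0} = waist r"
    using cat by (simp add: H_catenoid_def)
  obtain \<eta> where surf: "H_surface H S \<eta>"
    and up: "\<And>p. p \<in> S \<Longrightarrow> p$3 > 0 \<Longrightarrow> \<eta> p \<bullet> e3 > 0"
    and down: "\<And>p. p \<in> S \<Longrightarrow> p$3 < 0 \<Longrightarrow> \<eta> p \<bullet> e3 < 0"
    using cat unfolding H_catenoid_def by blast
  have normal: "0 < \<sigma> * (\<eta> p \<bullet> e3)" if "p \<in> S" "0 < \<sigma> * p$3" for p
    using \<sigma> up[of p] down[of p] that by auto
  have half: "S \<inter> {p. 0 \<le> \<sigma> * p$3} = waist r \<union> rotated_graph r f"
    and lim: "(f \<longlongrightarrow> 0) (at_right r)" "filterlim (\<lambda>x. \<sigma> * deriv f x) at_top (at_right r)"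
    and f'': "continuous_on {r<..} (deriv (deriv f))"
    using hgt by (simp_all add: end_height_def C2_profile_def)
  have f: "(f has_real_derivative deriv f x) (at x)"
    and f': "(deriv f has_real_derivative deriv (deriv f) x) (at x)" if "r < x" for x
    using hgt that
    by (simp_all add: end_height_def C2_profile_def DERIV_deriv_iff_field_differentiable)
  have sq: "(\<sigma> * q)\<^sup>2 = q\<^sup>2" for q using \<sigma> by (auto simp: power2_eq_square)
  show ?thesis
    unfolding height_profile_def
  proof (intro conjI allI impI)
    show "((\<lambda>x. \<sigma> * f x) \<longlongrightarrow> 0) (at_right r)"
      using lim(1) by (rule tendsto_mult_right_zero)
    show "filterlim (\<lambda>x. \<sigma> * deriv f x) at_top (at_right r)" by (rule lim(2))
    fix x assume x: "r < x"
    show "0 < \<sigma> * f x"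
      using end_off_plane[OF \<open>0 < r\<close> plane half _ x] \<sigma> by auto
    show "((\<lambda>x. \<sigma> * f x) has_real_derivative \<sigma> * deriv f x) (at x)"
      by (rule DERIV_cmult[OF f[OF x]])
    have "((\<lambda>x. \<sigma> * deriv f x) has_real_derivative \<sigma> * deriv (deriv f) x) (at x)"
      by (rule DERIV_cmult[OF f'[OF x]])
    also have "\<sigma> * deriv (deriv f) x = (1 + (\<sigma> * deriv f x)\<^sup>2) *
        (2 * sqrt (1 + (\<sigma> * deriv f x)\<^sup>2) * H (\<sigma> * (1 / sqrt (1 + (\<sigma> * deriv f x)\<^sup>2)))
          - \<sigma> * deriv f x / x)"
      using end_profile_equation[OF \<open>0 < r\<close> plane half \<sigma> f f' f'' surf normal x]
      by (simp add: sq)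
    finally show "((\<lambda>x. \<sigma> * deriv f x) has_real_derivative (1 + (\<sigma> * deriv f x)\<^sup>2) *
        (2 * sqrt (1 + (\<sigma> * deriv f x)\<^sup>2) * H (\<sigma> * (1 / sqrt (1 + (\<sigma> * deriv f x)\<^sup>2)))
          - \<sigma> * deriv f x / x)) (at x)" .
  qed
qed

lemma bounded_end_height_transfer:
  assumes H: "H \<in> frakC1" and \<sigma>: "\<sigma> = 1 \<or> \<sigma> = -1"
    and f: "0 < r" "H_catenoid H r S" "end_height \<sigma> r S f"
    and g: "0 < s" "H_catenoid H s T" "end_height \<sigma> s T g"
    and bdd: "bounded (f ` {r<..})"
  shows "bounded (g ` {s<..})"
proof -
  have neg: "H (\<sigma> * y) < 0" if "0 < y" "y < 1" for y
    using H that \<sigma> by (auto simp: frakC1_def)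
  have scale: "bounded ((\<lambda>x. \<sigma> * u x) ` A) \<longleftrightarrow> bounded (u ` A)" for u and A :: "real set"
  proof -
    have "norm (\<sigma> * q) = norm q" for q using \<sigma> by auto
    then show ?thesis by (simp only: bounded_iff ball_simps)
  qed
  have "bounded ((\<lambda>x. \<sigma> * g x) ` {s<..})"
  proof (rule bounded_height_transfer)
    show "height_profile (\<lambda>y. H (\<sigma> * y)) r (\<lambda>x. \<sigma> * f x) (\<lambda>x. \<sigma> * deriv f x)"
      by (rule end_height_imp_height_profile[OF f(2,1) \<sigma> f(3)])
    show "height_profile (\<lambda>y. H (\<sigma> * y)) s (\<lambda>x. \<sigma> * g x) (\<lambda>x. \<sigma> * deriv g x)"
      by (rule end_height_imp_height_profile[OF g(2,1) \<sigma> g(3)])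
    show "bounded ((\<lambda>x. \<sigma> * f x) ` {r<..})" by (simp only: scale bdd)
  qed (use neg f(1) g(1) in auto)
  then show ?thesis by (simp only: scale)
qed

theorem proposition3p2:
  fixes H :: "real \<Rightarrow> real" and r0 :: real and S0 :: "(real^3) set"
  assumes "H \<in> frakC1" and "r0 > 0" and "H_catenoid H r0 S0"
  shows "(unbounded_upper_height r0 S0 \<longrightarrow>
            (\<forall>r>0. \<forall>S. H_catenoid H r S \<longrightarrow> unbounded_upper_height r S)) \<and>
         (bounded_upper_height r0 S0 \<longrightarrow>
            (\<forall>r>0. \<forall>S. H_catenoid H r S \<longrightarrow> bounded_upper_height r S)) \<and>
         (unbounded_lower_height r0 S0 \<longrightarrow>
            (\<forall>r>0. \<forall>S. H_catenoid H r S \<longrightarrow> unbounded_lower_height r S)) \<and>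
         (bounded_lower_height r0 S0 \<longrightarrow>
            (\<forall>r>0. \<forall>S. H_catenoid H r S \<longrightarrow> bounded_lower_height r S))"
proof -
  note transfer = bounded_end_height_transfer[OF assms(1)]
  have up: "bounded (f ` {r<..}) \<Longrightarrow> bounded (g ` {s<..})"
    if "0 < r" "H_catenoid H r S" "upper_height r S f"
       "0 < s" "H_catenoid H s T" "upper_height s T g" for r s S T f g
    using transfer[of 1] that unfolding upper_height_eq_end_height by blast
  have low: "bounded (f ` {r<..}) \<Longrightarrow> bounded (g ` {s<..})"
    if "0 < r" "H_catenoid H r S" "lower_height r S f"
       "0 < s" "H_catenoid H s T" "lower_height s T g" for r s S T f g
    using transfer[of "- 1"] that unfolding lower_height_eq_end_height by blast
  have ex: "\<exists>f. upper_height r S f" "\<exists>f. lower_height r S f" if "H_catenoid H r S" for r S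
    using that unfolding H_catenoid_def by blast+
  note defs = unbounded_upper_height_def bounded_upper_height_def
    unbounded_lower_height_def bounded_lower_height_def
  show ?thesis
    unfolding defs using up low ex assms(2,3) by meson
qed

end
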